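(* Let $d,n\ge1$ be integers, let $\mathrm{M}$ be an $n$-dimensional linear subspace of the algebraic dual $\Pi'$ of $\Pi=\Pi(\mathbb{R}^d)$, and let $(\lambda_1,\dots,\lambda_n)$ be a graded basis of $\mathrm{M}$, with $\kappa_i:=\max\{k:\lambda_i\perp\Pi_{<k}\}$ for $i=1,\dots,n$. Define polynomials $$w_j:x\mapsto\lambda_j\|x-\cdot\|^{2\kappa_j},\qquad j=1,\dots,n,$$ and let $F:=\operatorname{span}(w_1,\dots,w_n)$. Then the Gram matrix $(\lambda_iw_j: i,j=1,\dots,n)$ is invertible. Hence, writing $\Lambda^{\mathrm t}:\Pi\to\mathbb{R}^n$, $p\mapsto(\lambda_ip)_{i=1}^n$, and $W:\mathbb{R}^n\to\Pi$, $a\mapsto\sum_ja(j)w_j$, the map $$P_S:=W(\Lambda^{\mathrm t}W)^{-1}\Lambda^{\mathrm t}$$ is the linear projector on $\Pi$ that associates with each $p\in\Pi$ the unique element $f\in F$ that matches $p$ at $\mathrm{M}$, i.e., satisfies $\mu f=\mu p$ for all $\mu\in\mathrm{M}$.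
   Context: $\Pi=\Pi(\mathbb{R}^d)$ is the real vector space of all polynomials with real coefficients in $d$ real variables, $\Pi'$ its algebraic dual, and $\Pi_{<k}$ the subspace of polynomials of total degree $<k$ ($\Pi_{<0}=\{0\}$). For $\lambda\in\Pi'$ and a subspace $V\subseteq\Pi$, $\lambda\perp V$ means that $\lambda$ vanishes on $V$, and ${\perp}V:=\{\mu\in\Pi':\mu\perp V\}$. A basis $(\lambda_1,\dots,\lambda_n)$ of $\mathrm{M}$ is called graded (by degree) if, with $\kappa_i:=\max\{k\in\mathbb{Z}_+:\lambda_i\perp\Pi_{<k}\}$, the sequence $(\kappa_1,\dots,\kappa_n)$ is nondecreasing and, for each $k$, the $\lambda_i$ with $\kappa_i\ge k$ form a basis of $\mathrm{M}\cap{\perp}\Pi_{<k}$. $\|\cdot\|$ is the Euclidean norm on $\mathbb{R}^d$, and $\lambda\|x-\cdot\|^{2k}$ is the value of $\lambda$ at the polynomial $y\mapsto\|x-y\|^{2k}$; as a function of $x$ it is a polynomial. *)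

theory Defs
  imports "HOL-Analysis.Analysis"
begin

(* Over the reals a polynomial is determined by the function it represents, so the
   space of polynomials in d real variables is the type of polynomial functions on
   real^'d, with d = CARD('d). *)
typedef 'd poly_space = "{f :: real^('d::finite) \<Rightarrow> real. real_polynomial_function f}"
  morphisms poly_eval Poly_space
  by (auto intro: real_polynomial_function.intros(2))

setup_lifting type_definition_poly_space

instantiation poly_space :: (finite) real_vector
begin

lift_definition zero_poly_space :: "'a poly_space" is "\<lambda>x. 0"
  by (rule real_polynomial_function.intros(2))

lift_definition plus_poly_space :: "'a poly_space \<Rightarrow> 'a poly_space \<Rightarrow> 'a poly_space"
  is "\<lambda>f g x. f x + g x"
  by (rule real_polynomial_function.intros(3))

lift_definition minus_poly_space :: "'a poly_space \<Rightarrow> 'a poly_space \<Rightarrow> 'a poly_space"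
  is "\<lambda>f g x. f x - g x"
  by (rule real_polynomial_function_diff)

lift_definition uminus_poly_space :: "'a poly_space \<Rightarrow> 'a poly_space"
  is "\<lambda>f x. - f x"
  by (rule real_polynomial_function_minus)

lift_definition scaleR_poly_space :: "real \<Rightarrow> 'a poly_space \<Rightarrow> 'a poly_space"
  is "\<lambda>c f x. c * f x"
  by (intro real_polynomial_function.intros(4) real_polynomial_function.intros(2))

instance
  by standard (transfer; simp add: algebra_simps fun_eq_iff)+

end

typedef (overloaded) 'a alg_dual = "{l :: 'a::real_vector \<Rightarrow> real. linear l}"
  morphisms dual_app Alg_dual
  using linear_zero by auto

setup_lifting type_definition_alg_dual

instantiation alg_dual :: (real_vector) real_vector
begin

lift_definition zero_alg_dual :: "'a alg_dual" is "\<lambda>p. 0"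
  by (rule linear_zero)

lift_definition plus_alg_dual :: "'a alg_dual \<Rightarrow> 'a alg_dual \<Rightarrow> 'a alg_dual"
  is "\<lambda>l m p. l p + m p"
  by (rule linear_compose_add)

lift_definition minus_alg_dual :: "'a alg_dual \<Rightarrow> 'a alg_dual \<Rightarrow> 'a alg_dual"
  is "\<lambda>l m p. l p - m p"
  by (rule linear_compose_sub)

lift_definition uminus_alg_dual :: "'a alg_dual \<Rightarrow> 'a alg_dual"
  is "\<lambda>l p. - l p"
  by (rule linear_compose_neg)

lift_definition scaleR_alg_dual :: "real \<Rightarrow> 'a alg_dual \<Rightarrow> 'a alg_dual"
  is "\<lambda>c l p. c * l p"
  by (rule linear_compose_scale_right[where 'b = real, unfolded real_scaleR_def])

instance
  by standard (transfer; simp add: algebra_simps fun_eq_iff)+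

end

lemma linear_dual_app: "linear (dual_app l)"
  using dual_app by auto

lift_definition monomial :: "('d::finite \<Rightarrow> nat) \<Rightarrow> 'd poly_space"
  is "\<lambda>\<alpha> x. \<Prod>i\<in>UNIV. (x $ i) ^ \<alpha> i"
  by (intro real_polynomial_function_prod real_polynomial_function_power
      real_polynomial_function.intros(1) bounded_linear_vec_nth) simp

lemma span_range_monomial: "span (range monomial) = (UNIV :: ('d::finite) poly_space set)"
proof -
  let ?S = "span (range (monomial :: _ \<Rightarrow> 'd poly_space))"
  have prod_closed: "Poly_space (\<lambda>x. poly_eval p x * poly_eval q x) \<in> ?S"
    if "p \<in> ?S" "q \<in> ?S" for p q
  proof -
    define m where "m p q = Poly_space (\<lambda>x. poly_eval p x * poly_eval q x)" for p q :: "'d poly_space"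
    have ev: "poly_eval (m p q) = (\<lambda>x. poly_eval p x * poly_eval q x)" for p q
      unfolding m_def using poly_eval[of p] poly_eval[of q]
      by (intro Poly_space_inverse) (auto intro: real_polynomial_function.intros(4))
    have lin1: "linear (\<lambda>p. m p q)" for q
      by (rule linearI; simp add: poly_eval_inject[symmetric] ev fun_eq_iff
          plus_poly_space.rep_eq scaleR_poly_space.rep_eq algebra_simps)
    have lin2: "linear (m p)" for p
      by (rule linearI; simp add: poly_eval_inject[symmetric] ev fun_eq_iff
          plus_poly_space.rep_eq scaleR_poly_space.rep_eq algebra_simps)
    have mm: "m (monomial \<alpha>) (monomial \<beta>) = monomial (\<lambda>i. \<alpha> i + \<beta> i)" for \<alpha> \<beta>
      by (simp add: poly_eval_inject[symmetric] ev fun_eq_iff monomial.rep_eq power_add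
          prod.distrib)
    have 1: "m (monomial \<alpha>) q \<in> ?S" if "q \<in> ?S" for \<alpha> q
    proof -
      have "m (monomial \<alpha>) ` ?S = span (m (monomial \<alpha>) ` range monomial)"
        by (rule linear_span_image[OF lin2, symmetric])
      also have "\<dots> \<subseteq> ?S"
        by (rule span_mono) (auto simp: mm)
      finally show ?thesis using that by blast
    qed
    have "(\<lambda>p. m p q) ` ?S = span ((\<lambda>p. m p q) ` range monomial)"
      by (rule linear_span_image[OF lin1, symmetric])
    also have "\<dots> \<subseteq> ?S"
      by (rule span_minimal) (auto intro: 1[OF that(2)])
    finally show ?thesis using that(1) by (auto simp: m_def)
  qed
  have const_closed: "Poly_space (\<lambda>x. c) \<in> ?S" for c
  proof -
    have "Poly_space (\<lambda>x. c) = c *\<^sub>R monomial (\<lambda>i. 0)"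
      by (simp add: poly_eval_inject[symmetric] Poly_space_inverse real_polynomial_function.intros(2)
          fun_eq_iff scaleR_poly_space.rep_eq monomial.rep_eq)
    then show ?thesis by (metis rangeI span_base span_scale)
  qed
  have "Poly_space f \<in> ?S" if "real_polynomial_function f" for f :: "real^'d \<Rightarrow> real"
    using that
  proof (induction f rule: real_polynomial_function.induct)
    case (linear f)
    have eval_sum: "poly_eval (sum g A) y = (\<Sum>i\<in>A. poly_eval (g i) y)"
      if "finite A" for g :: "'d \<Rightarrow> 'd poly_space" and A y
      using that by induction (simp_all add: zero_poly_space.rep_eq plus_poly_space.rep_eq)
    have coord: "(\<Prod>j\<in>UNIV. x $ j ^ of_bool (j = i)) = x $ i" for x :: "real^'d" and i
    proof -
      have "(\<Prod>j\<in>UNIV. x $ j ^ of_bool (j = i)) = (\<Prod>j\<in>UNIV. if j = i then x $ j else 1)"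
        by (rule prod.cong) auto
      then show ?thesis by simp
    qed
    have "f x = (\<Sum>i\<in>UNIV. f (axis i 1) * x $ i)" for x
    proof -
      have "f x = f (\<Sum>i\<in>UNIV. (x $ i) *\<^sub>R axis i 1)"
        by (simp only: basis_expansion scalar_mult_eq_scaleR[symmetric])
      also have "\<dots> = (\<Sum>i\<in>UNIV. f (axis i 1) * x $ i)"
        by (simp only: linear_sum[OF bounded_linear.linear[OF linear]]
            linear_scale[OF bounded_linear.linear[OF linear]] real_scaleR_def mult.commute)
      finally show ?thesis .
    qed
    moreover have "poly_eval (\<Sum>i\<in>UNIV. f (axis i 1) *\<^sub>R monomial (\<lambda>j. of_bool (j = i))) x
        = (\<Sum>i\<in>UNIV. f (axis i 1) * x $ i)" for x
      by (simp only: eval_sum[OF finite] scaleR_poly_space.rep_eq monomial.rep_eq coord)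
    ultimately have "f = poly_eval (\<Sum>i\<in>UNIV. f (axis i 1) *\<^sub>R monomial (\<lambda>j. of_bool (j = i)))"
      by (intro ext) (rule trans[OF _ sym])
    then have "Poly_space f = (\<Sum>i\<in>UNIV. f (axis i 1) *\<^sub>R monomial (\<lambda>j. of_bool (j = i)))"
      by (rule trans[OF arg_cong[where f = Poly_space] poly_eval_inverse])
    then show ?case by (simp add: span_base span_scale span_sum)
  next
    case (const c)
    show ?case by (rule const_closed)
  next
    case (add f g)
    from add have "Poly_space (\<lambda>x. f x + g x) = Poly_space f + Poly_space g"
      by (simp add: poly_eval_inject[symmetric] Poly_space_inverse real_polynomial_function.intros(3)
          fun_eq_iff plus_poly_space.rep_eq)
    then show ?case using add by (simp add: span_add)
  next
    case (mult f g)
    then show ?case using prod_closed[of "Poly_space f" "Poly_space g"]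
      by (simp add: Poly_space_inverse)
  qed
  then show ?thesis
    using poly_eval by (metis UNIV_eq_I mem_Collect_eq poly_eval_inverse)
qed

definition poly_lt :: "nat \<Rightarrow> ('d::finite) poly_space set" where
  "poly_lt k = span (monomial ` {\<alpha>. (\<Sum>i\<in>UNIV. \<alpha> i) < k})"

definition annihilates :: "'a::real_vector alg_dual \<Rightarrow> 'a set \<Rightarrow> bool" where
  "annihilates l V \<longleftrightarrow> (\<forall>p\<in>V. dual_app l p = 0)"

definition annihilator :: "'a::real_vector set \<Rightarrow> 'a alg_dual set" where
  "annihilator V = {l. annihilates l V}"

(* For l = 0 the set is all of nat and Max is unspecified; members of a basis are nonzero. *)
definition kappa :: "('d::finite) poly_space alg_dual \<Rightarrow> nat" where
  "kappa l = Max {k. annihilates l (poly_lt k)}"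

definition family_basis :: "'i set \<Rightarrow> ('i \<Rightarrow> 'a::real_vector) \<Rightarrow> 'a set \<Rightarrow> bool" where
  "family_basis I b V \<longleftrightarrow> inj_on b I \<and> independent (b ` I) \<and> span (b ` I) = V"

definition graded_basis ::
  "('n::{finite,linorder} \<Rightarrow> ('d::finite) poly_space alg_dual) \<Rightarrow> 'd poly_space alg_dual set \<Rightarrow> bool" where
  "graded_basis lam M \<longleftrightarrow>
     family_basis UNIV lam M \<and>
     mono (\<lambda>i. kappa (lam i)) \<and>
     (\<forall>k. family_basis {i. kappa (lam i) \<ge> k} lam (M \<inter> annihilator (poly_lt k)))"

lemma real_polynomial_function_norm_power:
  fixes x :: "real^('d::finite)"
  shows "real_polynomial_function (\<lambda>y. norm (x - y) ^ (2 * k))"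
proof -
  have "norm (x - y) ^ (2 * k) = (\<Sum>i\<in>UNIV. (x $ i - y $ i) * (x $ i - y $ i)) ^ k" for y
    by (simp add: power_mult power2_norm_eq_inner inner_vec_def)
  moreover have "real_polynomial_function (\<lambda>y::real^'d. y $ i)" for i
    by (intro real_polynomial_function.intros(1) bounded_linear_vec_nth)
  ultimately show ?thesis
    by (simp only:)
      (intro real_polynomial_function_power real_polynomial_function_sum
        real_polynomial_function.intros(4) real_polynomial_function_diff
        real_polynomial_function.intros(2) finite)
qed

lift_definition norm_power :: "nat \<Rightarrow> real^'d \<Rightarrow> ('d::finite) poly_space"
  is "\<lambda>k x y. norm (x - y) ^ (2 * k)"
  by (rule real_polynomial_function_norm_power)

lemma real_polynomial_function_dual_norm_power_aux:
  fixes l :: "('d::finite) poly_space alg_dual"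
  assumes "real_polynomial_function h"
  shows "real_polynomial_function
    (\<lambda>x. dual_app l (Poly_space (\<lambda>y. h y * norm (x - y) ^ (2 * k))))"
  using assms
proof (induction k arbitrary: h)
  case 0
  show ?case by (simp add: real_polynomial_function.intros(2))
next
  case (Suc k)
  have co: "real_polynomial_function (\<lambda>y::real^'d. y $ i)" for i
    by (intro real_polynomial_function.intros(1) bounded_linear_vec_nth)
  have sq: "real_polynomial_function (\<lambda>y::real^'d. y \<bullet> y)"
    unfolding inner_vec_def inner_real_def
    by (intro real_polynomial_function_sum real_polynomial_function.intros(4) co) simp
  let ?q = "\<lambda>x g. Poly_space (\<lambda>y. g y * norm (x - y) ^ (2 * k))"
  have ev: "poly_eval (?q x g) = (\<lambda>y. g y * norm (x - y) ^ (2 * k))"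
    if "real_polynomial_function g" for x and g :: "real^'d \<Rightarrow> real"
    using that by (intro Poly_space_inverse CollectI real_polynomial_function.intros(4)
        real_polynomial_function_norm_power)
  have eval_sum: "poly_eval (sum f A) y = (\<Sum>i\<in>A. poly_eval (f i) y)"
    if "finite A" for f :: "'d \<Rightarrow> 'd poly_space" and A y
    using that by induction (simp_all add: zero_poly_space.rep_eq plus_poly_space.rep_eq)
  have expand: "Poly_space (\<lambda>y. h y * norm (x - y) ^ (2 * Suc k)) =
      (x \<bullet> x) *\<^sub>R ?q x h - 2 *\<^sub>R (\<Sum>i\<in>UNIV. (x $ i) *\<^sub>R ?q x (\<lambda>y. h y * (y $ i)))
        + ?q x (\<lambda>y. h y * (y \<bullet> y))" (is "_ = ?R") for x
  proof -
    have "poly_eval ?R y = h y * norm (x - y) ^ (2 * Suc k)" for y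
    proof -
      have "norm (x - y) ^ (2 * Suc k)
          = (x \<bullet> x - 2 * (\<Sum>i\<in>UNIV. x $ i * y $ i) + y \<bullet> y) * norm (x - y) ^ (2 * k)"
      proof -
        have "norm (x - y) ^ 2 = x \<bullet> x - 2 * (\<Sum>i\<in>UNIV. x $ i * y $ i) + y \<bullet> y"
          unfolding power2_norm_eq_inner
          by (simp add: inner_diff inner_commute[of y x] inner_vec_def[of x y])
        then show ?thesis
          by (simp only: mult_Suc_right power_add)
      qed
      moreover have "poly_eval ?R y =
          (x \<bullet> x) * (h y * norm (x - y) ^ (2 * k))
            - 2 * (\<Sum>i\<in>UNIV. x $ i * (h y * y $ i * norm (x - y) ^ (2 * k)))
            + h y * (y \<bullet> y) * norm (x - y) ^ (2 * k)"
        by (simp only: plus_poly_space.rep_eq minus_poly_space.rep_eq scaleR_poly_space.rep_eq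
            eval_sum[OF finite] ev real_polynomial_function.intros(4) Suc.prems co sq)
      moreover have "(\<Sum>i\<in>UNIV. x $ i * (h y * y $ i * norm (x - y) ^ (2 * k)))
          = h y * (\<Sum>i\<in>UNIV. x $ i * y $ i) * norm (x - y) ^ (2 * k)"
        by (simp add: sum_distrib_left sum_distrib_right algebra_simps)
      moreover have "a * (c * N) - 2 * (c * s * N) + c * b * N = c * ((a - 2 * s + b) * N)"
        for a b c s N :: real
        by (simp add: algebra_simps)
      ultimately show ?thesis
        by (simp only:)
    qed
    then have "poly_eval ?R = (\<lambda>y. h y * norm (x - y) ^ (2 * Suc k))"
      by (rule ext)
    from arg_cong[where f = Poly_space, OF this] show ?thesis
      by (simp only: poly_eval_inverse)
  qed
  have "dual_app l (Poly_space (\<lambda>y. h y * norm (x - y) ^ (2 * Suc k))) =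
      (x \<bullet> x) * dual_app l (?q x h)
        - 2 * (\<Sum>i\<in>UNIV. (x $ i) * dual_app l (?q x (\<lambda>y. h y * (y $ i))))
        + dual_app l (?q x (\<lambda>y. h y * (y \<bullet> y)))" for x
    unfolding expand
    by (simp only: linear_add[OF linear_dual_app] linear_diff[OF linear_dual_app]
        linear_scale[OF linear_dual_app] linear_sum[OF linear_dual_app] real_scaleR_def)
  then show ?case
    by (simp only:)
      (intro real_polynomial_function.intros(3) real_polynomial_function_diff
        real_polynomial_function.intros(4) real_polynomial_function.intros(2)
        real_polynomial_function_sum Suc.IH Suc.prems co sq finite)
qed

lift_definition dual_norm_power :: "nat \<Rightarrow> ('d::finite) poly_space alg_dual \<Rightarrow> 'd poly_space"
  is "\<lambda>k l x. dual_app l (norm_power k x)"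
  using real_polynomial_function_dual_norm_power_aux[OF real_polynomial_function.intros(2)[of 1]]
  by (simp add: norm_power_def)

definition w_poly ::
  "('n \<Rightarrow> ('d::finite) poly_space alg_dual) \<Rightarrow> 'n \<Rightarrow> 'd poly_space" where
  "w_poly lam j = dual_norm_power (kappa (lam j)) (lam j)"

definition Lambda_t ::
  "('n::finite \<Rightarrow> ('d::finite) poly_space alg_dual) \<Rightarrow> 'd poly_space \<Rightarrow> real^'n" where
  "Lambda_t lam p = (\<chi> i. dual_app (lam i) p)"

definition W_map ::
  "('n::finite \<Rightarrow> ('d::finite) poly_space alg_dual) \<Rightarrow> real^'n \<Rightarrow> 'd poly_space" where
  "W_map lam a = (\<Sum>j\<in>UNIV. (a $ j) *\<^sub>R w_poly lam j)"

definition gram :: "('n::finite \<Rightarrow> ('d::finite) poly_space alg_dual) \<Rightarrow> real^'n^'n" where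
  "gram lam = (\<chi> i j. dual_app (lam i) (w_poly lam j))"

definition P_S ::
  "('n::finite \<Rightarrow> ('d::finite) poly_space alg_dual) \<Rightarrow> 'd poly_space \<Rightarrow> 'd poly_space" where
  "P_S lam = W_map lam \<circ> inv (Lambda_t lam \<circ> W_map lam) \<circ> Lambda_t lam"

end

theory Submission
  imports Defs
begin

text \<open>
  Expanding \<open>\<parallel>x - y\<parallel>\<^sup>2 = \<parallel>x\<parallel>\<^sup>2 - 2 x\<cdot>y + \<parallel>y\<parallel>\<^sup>2\<close> to the power \<open>k\<close> writes the kernel as a combination of
  terms \<open>\<parallel>x\<parallel>\<^sup>2\<^sup>a (-2 x\<cdot>y)\<^sup>b \<parallel>y\<parallel>\<^sup>2\<^sup>c\<close> with \<open>a + b + c = k\<close>.  A functional in \<open>y\<close> that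
  annihilates degrees below \<open>k\<close> kills the terms with \<open>c < a\<close>, and one in \<open>x\<close> kills those with \<open>a < c\<close>;
  if the latter annihilates degree \<open>k\<close> as well, nothing is left, so the Gram matrix is block triangular.
  On a diagonal block only \<open>a = c\<close> survives.  These terms all carry the sign \<open>(-1)\<^sup>k\<close> and are, up to sign,
  sums of squares in the functional; the term with \<open>a = c = 0\<close> vanishes only if the functional
  annihilates all monomials of degree \<open>k\<close>.  In a graded basis no nontrivial combination of the
  functionals of order exactly \<open>k\<close> does so.
\<close>

section \<open>Polynomials and functionals\<close>

lemma poly_eval_sum: "poly_eval (sum f A) x = (\<Sum>i\<in>A. poly_eval (f i) x)"
  by (induction A rule: infinite_finite_induct)
    (simp_all add: zero_poly_space.rep_eq plus_poly_space.rep_eq)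

lemma dual_app_sum: "dual_app (sum f A) p = (\<Sum>i\<in>A. dual_app (f i) p)"
  by (induction A rule: infinite_finite_induct)
    (simp_all add: zero_alg_dual.rep_eq plus_alg_dual.rep_eq)

lemma linear_dual_app_left: "linear (\<lambda>l. dual_app l p)"
  by (rule linearI) (simp_all add: plus_alg_dual.rep_eq scaleR_alg_dual.rep_eq)

text \<open>\<open>poly_space\<close> carries only its vector space structure, so products are built
  one coordinate at a time; each factor raises the degree bound by one.\<close>

lift_definition coord_mult :: "'d \<Rightarrow> ('d::finite) poly_space \<Rightarrow> 'd poly_space"
  is "\<lambda>i f x. x $ i * f x"
  by (intro real_polynomial_function.intros(4))
    (auto intro: real_polynomial_function.intros(1) bounded_linear_vec_nth)

lemma linear_coord_mult: "linear (coord_mult i)"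
  by (rule linearI; simp add: poly_eval_inject[symmetric] coord_mult.rep_eq fun_eq_iff
      plus_poly_space.rep_eq scaleR_poly_space.rep_eq algebra_simps)

lemma coord_mult_monomial: "coord_mult i (monomial \<alpha>) = monomial (\<alpha>(i := Suc (\<alpha> i)))"
proof -
  have "x $ i * (\<Prod>j\<in>UNIV. x $ j ^ \<alpha> j) = (\<Prod>j\<in>UNIV. x $ j ^ (\<alpha>(i := Suc (\<alpha> i))) j)"
    for x :: "real^'a"
    by (simp add: prod.remove[of UNIV i])
  then show ?thesis
    by (simp only: poly_eval_inject[symmetric] coord_mult.rep_eq monomial.rep_eq)
qed

lemma sum_upd_Suc: "(\<Sum>j\<in>UNIV. (\<alpha>(i := Suc (\<alpha> i))) j) = Suc (\<Sum>j\<in>UNIV. \<alpha> j)"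
  for \<alpha> :: "'d::finite \<Rightarrow> nat"
  by (simp add: sum.remove[of UNIV i])

lemma poly_lt_mono: "k \<le> m \<Longrightarrow> poly_lt k \<subseteq> poly_lt m"
  unfolding poly_lt_def by (rule span_mono) auto

lemma subspace_poly_lt: "subspace (poly_lt k)"
  unfolding poly_lt_def by (rule subspace_span)

lemma coord_mult_poly_lt:
  assumes "p \<in> poly_lt k"
  shows "coord_mult i p \<in> poly_lt (Suc k)"
proof -
  have "coord_mult i ` poly_lt k = span (coord_mult i ` monomial ` {\<alpha>. (\<Sum>i\<in>UNIV. \<alpha> i) < k})"
    unfolding poly_lt_def by (rule linear_span_image[OF linear_coord_mult, symmetric])
  also have "\<dots> \<subseteq> poly_lt (Suc k)"
    unfolding poly_lt_def
  proof (rule span_mono, safe)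
    fix \<alpha> :: "'a \<Rightarrow> nat" assume "(\<Sum>i\<in>UNIV. \<alpha> i) < k"
    then show "coord_mult i (monomial \<alpha>) \<in> monomial ` {\<alpha>. (\<Sum>i\<in>UNIV. \<alpha> i) < Suc k}"
      unfolding coord_mult_monomial by (intro imageI CollectI) (simp only: sum_upd_Suc Suc_less_eq)
  qed
  finally show ?thesis using assms by blast
qed

lemma annihilates_mono: "annihilates l (poly_lt m) \<Longrightarrow> k \<le> m \<Longrightarrow> annihilates l (poly_lt k)"
  using poly_lt_mono unfolding annihilates_def by blast

lemma annihilates_span:
  assumes "\<And>p. p \<in> S \<Longrightarrow> dual_app l p = 0"
  shows "annihilates l (span S)"
  using linear_eq_0_on_span[OF linear_dual_app assms] by (auto simp: annihilates_def)

lemma subspace_annihilator: "subspace (annihilator V)"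
  by (auto simp: subspace_def annihilator_def annihilates_def zero_alg_dual.rep_eq
      plus_alg_dual.rep_eq scaleR_alg_dual.rep_eq)

text \<open>Monomials span, so a nonzero functional is nonzero at some monomial, whose degree bounds
  the set in \<open>kappa\<close>. Being finite and containing 0, the set attains its
  \<open>Max\<close>.\<close>

lemma annihilates_poly_lt_kappa:
  assumes "l \<noteq> 0"
  shows "annihilates l (poly_lt (kappa l))"
proof -
  have "\<exists>\<alpha>. dual_app l (monomial \<alpha>) \<noteq> 0"
  proof (rule ccontr)
    assume "\<nexists>\<alpha>. dual_app l (monomial \<alpha>) \<noteq> 0"
    then have "annihilates l (span (range monomial))"
      by (intro annihilates_span) auto
    then have "l = 0"
      by (simp add: span_range_monomial annihilates_def dual_app_inject[symmetric] fun_eq_iff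
          zero_alg_dual.rep_eq)
    with assms show False by simp
  qed
  then obtain \<alpha> where \<alpha>: "dual_app l (monomial \<alpha>) \<noteq> 0" ..
  have "k \<le> (\<Sum>i\<in>UNIV. \<alpha> i)" if "annihilates l (poly_lt k)" for k
  proof (rule ccontr)
    assume "\<not> k \<le> (\<Sum>i\<in>UNIV. \<alpha> i)"
    then have "monomial \<alpha> \<in> poly_lt k"
      unfolding poly_lt_def by (intro span_base) auto
    with that \<alpha> show False by (auto simp: annihilates_def)
  qed
  then have "finite {k. annihilates l (poly_lt k)}"
    by (auto intro: finite_subset[of _ "{..(\<Sum>i\<in>UNIV. \<alpha> i)}"])
  moreover have "0 \<in> {k. annihilates l (poly_lt k)}"
    by (simp add: annihilates_def poly_lt_def linear_0[OF linear_dual_app])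
  ultimately have "Max {k. annihilates l (poly_lt k)} \<in> {k. annihilates l (poly_lt k)}"
    by (intro Max_in) auto
  then show ?thesis by (simp only: kappa_def mem_Collect_eq)
qed

section \<open>Expansion of the kernel\<close>

text \<open>\<open>norm_mono a l\<close> is \<open>\<parallel>x\<parallel>\<^sup>2\<^sup>a\<close> times the product of the coordinates listed in \<open>l\<close>.  Indexing monomials
  by lists instead of exponents makes \<open>(x\<cdot>y)\<^sup>b\<close> a sum without multinomial coefficients.\<close>

fun norm_mono :: "nat \<Rightarrow> 'd list \<Rightarrow> ('d::finite) poly_space" where
  "norm_mono 0 [] = monomial (\<lambda>_. 0)"
| "norm_mono 0 (i # l) = coord_mult i (norm_mono 0 l)"
| "norm_mono (Suc a) l = (\<Sum>i\<in>UNIV. coord_mult i (coord_mult i (norm_mono a l)))"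

lemma poly_eval_norm_mono:
  "poly_eval (norm_mono a l) x = (x \<bullet> x) ^ a * prod_list (map (($) x) l)"
  by (induction a l rule: norm_mono.induct)
    (simp_all add: monomial.rep_eq coord_mult.rep_eq poly_eval_sum inner_vec_def
      sum_distrib_right sum_distrib_left mult.assoc)

lemma norm_mono_in_poly_lt: "norm_mono a l \<in> poly_lt (Suc (2 * a + length l))"
proof (induction a l rule: norm_mono.induct)
  case 1
  then show ?case by (auto simp: poly_lt_def intro!: span_base)
next
  case (2 i l)
  then show ?case by (simp add: coord_mult_poly_lt)
next
  case (3 a l)
  then show ?case
    by (auto intro!: subspace_sum[OF subspace_poly_lt] coord_mult_poly_lt)
qed

text \<open>Peel off a variable of positive exponent at each step. This leads from lists back to the
  monomials that span \<open>poly_lt\<close>.\<close>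

lemma monomial_eq_norm_mono:
  "(\<Sum>i\<in>UNIV. \<alpha> i) = k \<Longrightarrow> \<exists>l. length l = k \<and> monomial \<alpha> = norm_mono 0 l"
proof (induction k arbitrary: \<alpha>)
  case 0
  then have "\<alpha> = (\<lambda>_. 0)" by (simp add: fun_eq_iff)
  then show ?case by (intro exI[of _ "[]"]) simp
next
  case (Suc k)
  then obtain i where i: "\<alpha> i \<noteq> 0"
    by (metis Zero_not_Suc sum.neutral)
  define \<beta> where "\<beta> = \<alpha>(i := \<alpha> i - 1)"
  have \<alpha>: "\<alpha> = \<beta>(i := Suc (\<beta> i))" using i by (auto simp: \<beta>_def)
  have "(\<Sum>i\<in>UNIV. \<beta> i) = k"
    using Suc.prems sum_upd_Suc[of \<beta> i] unfolding \<alpha>[symmetric] by simp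
  from Suc.IH[OF this] obtain l where l: "length l = k" "monomial \<beta> = norm_mono 0 l" by blast
  have "monomial \<alpha> = norm_mono 0 (i # l)"
    by (subst \<alpha>) (simp add: coord_mult_monomial[symmetric] l)
  with l(1) show ?case by (intro exI[of _ "i # l"]) simp
qed

lemma finite_lists_length: "finite {l :: 'd::finite list. length l = n}"
  using finite_lists_length_eq[of "UNIV :: 'd set" n] by simp

text \<open>Multiplying out \<open>n\<close> factors chooses one coordinate per factor, hence a
  list. The same list serves \<open>x\<close> and \<open>y\<close>, which later yields
  squares.\<close>

lemma inner_power_eq_sum_lists:
  fixes x y :: "real^('d::finite)"
  shows "(x \<bullet> y) ^ n =
    (\<Sum>l | length l = n. prod_list (map (($) x) l) * prod_list (map (($) y) l))"
proof (induction n)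
  case 0
  then show ?case by simp
next
  case (Suc n)
  let ?h = "\<lambda>l. prod_list (map (($) x) l) * prod_list (map (($) y) l)"
  have "(\<Sum>l | length l = Suc n. ?h l)
      = (\<Sum>(i, l) \<in> UNIV \<times> {l. length l = n}. ?h (i # l))"
    by (rule sum.reindex_bij_witness[of _ "\<lambda>(i, l). i # l" "\<lambda>l. (hd l, tl l)"])
      (auto simp: length_Suc_conv)
  also have "\<dots> = (\<Sum>i\<in>UNIV. \<Sum>l | length l = n. x $ i * y $ i * ?h l)"
    by (simp add: sum.cartesian_product algebra_simps)
  also have "\<dots> = (\<Sum>i\<in>UNIV. x $ i * y $ i) * (\<Sum>l | length l = n. ?h l)"
    by (simp add: sum_product)
  finally show ?case using Suc.IH by (simp add: inner_vec_def)
qed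

text \<open>For \<open>a + b \<le> k\<close>, the trinomial coefficient of \<open>a\<close>,
  \<open>b\<close>, \<open>k - a - b\<close> times \<open>(-2) ^ b\<close>, in the form that two
  nested binomial expansions produce.\<close>

definition kernel_coeff :: "nat \<Rightarrow> nat \<Rightarrow> nat \<Rightarrow> real" where
  "kernel_coeff k a b = real (k choose a) * real ((k - a) choose b) * (-2) ^ b"

lemma norm_power_expand:
  "norm_power k x = (\<Sum>a\<le>k. \<Sum>b\<le>k - a. \<Sum>l | length l = b.
     (kernel_coeff k a b * poly_eval (norm_mono a l) x) *\<^sub>R norm_mono (k - a - b) l)"
proof -
  have "norm (x - y) ^ (2 * k) = (\<Sum>a\<le>k. \<Sum>b\<le>k - a. \<Sum>l | length l = b.
     (kernel_coeff k a b * poly_eval (norm_mono a l) x) * poly_eval (norm_mono (k - a - b) l) y)"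
    for y
  proof -
    have "norm (x - y) ^ 2 = x \<bullet> x + (-2 * (x \<bullet> y) + y \<bullet> y)"
      unfolding power2_norm_eq_inner by (simp add: inner_diff inner_commute[of y x])
    then have "norm (x - y) ^ (2 * k) = (x \<bullet> x + (-2 * (x \<bullet> y) + y \<bullet> y)) ^ k"
      by (simp only: power_mult)
    also have "\<dots> = (\<Sum>a\<le>k. real (k choose a) * (x \<bullet> x) ^ a *
        (\<Sum>b\<le>k - a. real ((k - a) choose b) * (-2 * (x \<bullet> y)) ^ b * (y \<bullet> y) ^ (k - a - b)))"
      by (simp only: binomial_ring)
    also have "\<dots> = (\<Sum>a\<le>k. \<Sum>b\<le>k - a. kernel_coeff k a b *
        ((x \<bullet> x) ^ a * (x \<bullet> y) ^ b * (y \<bullet> y) ^ (k - a - b)))"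
      unfolding kernel_coeff_def power_mult_distrib sum_distrib_left
      by (intro sum.cong refl) (simp only: mult_ac)
    also have "\<dots> = (\<Sum>a\<le>k. \<Sum>b\<le>k - a. \<Sum>l | length l = b.
     (kernel_coeff k a b * poly_eval (norm_mono a l) x) * poly_eval (norm_mono (k - a - b) l) y)"
      unfolding inner_power_eq_sum_lists[of x y] poly_eval_norm_mono sum_distrib_left sum_distrib_right
      by (intro sum.cong refl) (simp only: mult_ac)
    finally show ?thesis .
  qed
  then show ?thesis
    by (simp add: poly_eval_inject[symmetric] fun_eq_iff norm_power.rep_eq poly_eval_sum
        scaleR_poly_space.rep_eq)
qed

text \<open>The expansion separates \<open>x\<close> from \<open>y\<close>, so each functional acts
  on its own factor. The degrees \<open>2 * a + b\<close> and \<open>2 * (k - a - b) + b\<close> of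
  these factors add up to \<open>2 * k\<close>; the block structure rests on this.\<close>

lemma dual_app_dual_norm_power:
  "dual_app m (dual_norm_power k l) = (\<Sum>a\<le>k. \<Sum>b\<le>k - a. kernel_coeff k a b *
     (\<Sum>s | length s = b. dual_app m (norm_mono a s) * dual_app l (norm_mono (k - a - b) s)))"
proof -
  have "dual_norm_power k l = (\<Sum>a\<le>k. \<Sum>b\<le>k - a. \<Sum>s | length s = b.
     (kernel_coeff k a b * dual_app l (norm_mono (k - a - b) s)) *\<^sub>R norm_mono a s)"
    by (simp add: poly_eval_inject[symmetric] fun_eq_iff dual_norm_power.rep_eq poly_eval_sum
        scaleR_poly_space.rep_eq norm_power_expand linear_sum[OF linear_dual_app]
        linear_scale[OF linear_dual_app] mult_ac)
  then show ?thesis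
    by (simp add: linear_sum[OF linear_dual_app] linear_scale[OF linear_dual_app]
        sum_distrib_left mult_ac)
qed

lemma linear_dual_norm_power: "linear (dual_norm_power k)"
  by (rule linearI; simp add: poly_eval_inject[symmetric] fun_eq_iff dual_norm_power.rep_eq
      plus_poly_space.rep_eq scaleR_poly_space.rep_eq plus_alg_dual.rep_eq scaleR_alg_dual.rep_eq)

lemma annihilates_norm_mono:
  assumes "annihilates l (poly_lt k)" and "2 * a + length s < k"
  shows "dual_app l (norm_mono a s) = 0"
  using assms norm_mono_in_poly_lt[of a s] poly_lt_mono[of "Suc (2 * a + length s)" k]
  by (auto simp: annihilates_def)

section \<open>Block structure of the Gram matrix\<close>

text \<open>As the two degrees add up to \<open>2 * k\<close>, either the first is at most
  \<open>k\<close> and \<open>m\<close> vanishes, or the second is below \<open>k\<close> and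
  \<open>l\<close> vanishes.\<close>

lemma dual_norm_power_orthogonal:
  assumes "annihilates l (poly_lt k)" and "annihilates m (poly_lt (Suc k))"
  shows "dual_app m (dual_norm_power k l) = 0"
proof -
  have "dual_app m (norm_mono a s) * dual_app l (norm_mono (k - a - length s) s) = 0"
    if "a \<le> k" "length s \<le> k - a" for a s
  proof (cases "2 * a + length s < Suc k")
    case True
    then show ?thesis by (simp add: annihilates_norm_mono[OF assms(2)])
  next
    case False
    then have "2 * (k - a - length s) + length s < k" using that by linarith
    then show ?thesis by (simp add: annihilates_norm_mono[OF assms(1)])
  qed
  then show ?thesis
    unfolding dual_app_dual_norm_power
    by (auto intro!: sum.neutral simp del: mult_eq_0_iff)
qed

lemma dual_norm_power_definite:
  assumes l: "annihilates l (poly_lt k)" and 0: "dual_app l (dual_norm_power k l) = 0"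
  shows "annihilates l (poly_lt (Suc k))"
proof -
  define t where "t a b = kernel_coeff k a b *
     (\<Sum>s | length s = b. dual_app l (norm_mono a s) * dual_app l (norm_mono (k - a - b) s))" for a b
  \<comment> \<open>If \<open>2 * a + b = k\<close>, both functional factors coincide and
    \<open>b\<close> has the parity of \<open>k\<close>, so \<open>(-1) ^ k\<close> cancels the sign
    of \<open>kernel_coeff\<close>.\<close>
  have t_sign: "0 \<le> (-1) ^ k * t a b" if ab: "a \<le> k" "b \<le> k - a" for a b
  proof (cases "2 * a + b = k")
    case True
    then have "k - a - b = a" by simp
    moreover have "(-1) ^ k * (-2) ^ b = (2::real) ^ b"
    proof -
      have "(-1::real) ^ k = (-1) ^ b" using True[symmetric] by (simp add: power_add)
      then show ?thesis by (simp add: power_mult_distrib[symmetric])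
    qed
    ultimately have "(-1) ^ k * t a b = real (k choose a) * real ((k - a) choose b) * 2 ^ b *
        (\<Sum>s | length s = b. dual_app l (norm_mono a s) ^ 2)"
      by (simp add: t_def kernel_coeff_def power2_eq_square)
    then show ?thesis by (simp add: sum_nonneg)
  next
    case False
    \<comment> \<open>Two degrees with sum \<open>2 * k\<close> that are not both \<open>k\<close>:
      one is below \<open>k\<close>, where \<open>l\<close> vanishes.\<close>
    then consider "2 * a + b < k" | "2 * (k - a - b) + b < k" using ab by linarith
    then have "t a b = 0"
      unfolding t_def
      by cases (auto simp: annihilates_norm_mono[OF l] intro!: sum.neutral)
    then show ?thesis by simp
  qed
  have "(\<Sum>a\<le>k. \<Sum>b\<le>k - a. (-1) ^ k * t a b) = 0"
    using 0 by (simp add: dual_app_dual_norm_power t_def sum_distrib_left[symmetric])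
  then have "\<forall>a\<le>k. (\<Sum>b\<le>k - a. (-1) ^ k * t a b) = 0"
    by (subst (asm) sum_nonneg_eq_0_iff) (auto intro!: sum_nonneg t_sign)
  \<comment> \<open>Pick out \<open>a = 0\<close>, then \<open>b = k\<close>: there the polynomials
    are the plain monomials of degree \<open>k\<close>.\<close>
  then have "(\<Sum>b\<le>k. (-1) ^ k * t 0 b) = 0" by force
  then have "\<forall>b\<le>k. (-1) ^ k * t 0 b = 0"
    by (subst (asm) sum_nonneg_eq_0_iff) (auto intro!: t_sign)
  then have "t 0 k = 0" by simp
  then have "(\<Sum>s | length s = k. dual_app l (norm_mono 0 s) ^ 2) = 0"
    by (simp add: t_def kernel_coeff_def power2_eq_square)
  then have mono0: "dual_app l (norm_mono 0 s) = 0" if "length s = k" for s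
    using that by (subst (asm) sum_nonneg_eq_0_iff) (auto simp: finite_lists_length)
  show ?thesis
    unfolding poly_lt_def
  proof (rule annihilates_span, safe)
    fix \<alpha> :: "'a \<Rightarrow> nat" assume "(\<Sum>i\<in>UNIV. \<alpha> i) < Suc k"
    then consider "(\<Sum>i\<in>UNIV. \<alpha> i) < k" | "(\<Sum>i\<in>UNIV. \<alpha> i) = k" by linarith
    then show "dual_app l (monomial \<alpha>) = 0"
    proof cases
      case 1
      then have "monomial \<alpha> \<in> poly_lt k"
        unfolding poly_lt_def by (intro span_base) auto
      then show ?thesis using l by (simp add: annihilates_def)
    next
      case 2
      from monomial_eq_norm_mono[OF this] mono0 show ?thesis by auto
    qed
  qed
qed

text \<open>\<open>independent\<close> speaks about a set; injectivity of \<open>lam\<close> carries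
  the coefficients over to its range.\<close>

lemma family_basis_coeffs_zero:
  fixes lam :: "'n::finite \<Rightarrow> 'a::real_vector"
  assumes "family_basis UNIV lam M" and "(\<Sum>i\<in>UNIV. c i *\<^sub>R lam i) = 0"
  shows "c i = 0"
proof -
  have inj: "inj lam" and ind: "independent (range lam)"
    using assms(1) by (auto simp: family_basis_def)
  have "(\<Sum>v\<in>range lam. c (inv lam v) *\<^sub>R v) = 0"
    using assms(2) by (simp add: sum.reindex[OF inj] inv_f_f[OF inj])
  then have "c (inv lam (lam i)) = 0"
    by (intro independentD[OF ind, of "range lam" "\<lambda>v. c (inv lam v)"]) auto
  then show ?thesis by (simp add: inv_f_f[OF inj])
qed

text \<open>\<open>lam\<close> may repeat values, so representatives \<open>J\<close> are chosen and
  the remaining coefficients set to 0. This allows the use for \<open>w_poly\<close>.\<close>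

lemma span_image_finite_obtain:
  fixes lam :: "'n \<Rightarrow> 'a::real_vector"
  assumes "finite I" and "v \<in> span (lam ` I)"
  obtains d where "v = (\<Sum>i\<in>I. d i *\<^sub>R lam i)"
proof -
  obtain J where J: "J \<subseteq> I" "inj_on lam J" "lam ` I = lam ` J"
    using subset_image_inj[of "lam ` I" lam I] by auto
  then have "finite (lam ` J)" by (simp add: assms(1) flip: J(3))
  with assms(2) J(3) obtain u where "v = (\<Sum>w\<in>lam ` J. u w *\<^sub>R w)"
    by (auto simp: span_finite)
  also have "\<dots> = (\<Sum>i\<in>J. u (lam i) *\<^sub>R lam i)"
    by (simp add: sum.reindex[OF J(2)])
  also have "\<dots> = (\<Sum>i\<in>I. (if i \<in> J then u (lam i) else 0) *\<^sub>R lam i)"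
    by (rule sum.mono_neutral_cong_left) (use assms(1) J(1) in auto)
  finally show thesis by (rule that)
qed

text \<open>Let \<open>l\<close> be the part of the combination of highest order \<open>k\<close>.
  Triangularity and definiteness make it annihilate degree \<open>k\<close> too; gradedness then
  writes it by functionals of order above \<open>k\<close>, against independence.\<close>

lemma graded_basis_gram_kernel:
  fixes lam :: "'n::{finite,linorder} \<Rightarrow> ('d::finite) poly_space alg_dual"
  assumes graded: "graded_basis lam M" and ker: "gram lam *v c = 0"
  shows "c = 0"
proof (rule ccontr)
  assume "c \<noteq> 0"
  let ?\<kappa> = "\<lambda>i. kappa (lam i)"
  have basis: "family_basis UNIV lam M"
    and basis_ge: "\<And>k. family_basis {i. k \<le> ?\<kappa> i} lam (M \<inter> annihilator (poly_lt k))"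
    using graded by (auto simp: graded_basis_def)
  have "0 \<notin> range lam"
    using basis dependent_zero[of "range lam"] unfolding family_basis_def by blast
  then have "lam i \<noteq> 0" for i
    by (metis rangeI)
  then have ann: "annihilates (lam i) (poly_lt (?\<kappa> i))" for i
    by (rule annihilates_poly_lt_kappa)
  have "{j. c $ j \<noteq> 0} \<noteq> {}" using \<open>c \<noteq> 0\<close> by (auto simp: vec_eq_iff)
  then have "Max (?\<kappa> ` {j. c $ j \<noteq> 0}) \<in> ?\<kappa> ` {j. c $ j \<noteq> 0}" by (intro Max_in) auto
  then obtain j0
    where j0: "Max (?\<kappa> ` {j. c $ j \<noteq> 0}) = ?\<kappa> j0" "j0 \<in> {j. c $ j \<noteq> 0}"
    by (rule imageE)
  define k where "k = ?\<kappa> j0"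
  have above: "c $ j = 0" if "k < ?\<kappa> j" for j
  proof (rule ccontr)
    assume "c $ j \<noteq> 0"
    then have "?\<kappa> j \<le> k" unfolding k_def j0(1)[symmetric] by (intro Max_ge) auto
    with that show False by simp
  qed
  define J where "J = {j. ?\<kappa> j = k}"
  define l where "l = (\<Sum>j\<in>J. c $ j *\<^sub>R lam j)"
  have "lam j \<in> annihilator (poly_lt k)" if "j \<in> J" for j
    using that ann[of j] by (simp add: J_def annihilator_def)
  then have "l \<in> annihilator (poly_lt k)"
    unfolding l_def by (intro subspace_sum subspace_scale subspace_annihilator)
  then have l_ann: "annihilates l (poly_lt k)" by (simp add: annihilator_def)
  have "dual_app (lam i) (dual_norm_power k l) = 0" if "i \<in> J" for i
  proof -
    have "0 = (\<Sum>j\<in>UNIV. dual_app (lam i) (w_poly lam j) * c $ j)"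
      using arg_cong[where f = "\<lambda>v. v $ i", OF ker] by (simp add: matrix_vector_mult_def gram_def)
    also have "\<dots> = (\<Sum>j\<in>J. dual_app (lam i) (w_poly lam j) * c $ j)"
    proof (rule sum.mono_neutral_right)
      show "\<forall>j\<in>UNIV - J. dual_app (lam i) (w_poly lam j) * c $ j = 0"
      proof
        fix j assume "j \<in> UNIV - J"
        then consider "?\<kappa> j < k" | "k < ?\<kappa> j" by (cases "?\<kappa> j < k") (auto simp: J_def)
        then show "dual_app (lam i) (w_poly lam j) * c $ j = 0"
        proof cases
          case 1
          \<comment> \<open>The order \<open>k\<close> of \<open>lam i\<close> exceeds that of
            \<open>lam j\<close>, which gives the extra degree that orthogonality asks for.\<close>
          with that have "annihilates (lam i) (poly_lt (Suc (?\<kappa> j)))"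
            by (intro annihilates_mono[OF ann]) (simp add: J_def)
          then show ?thesis by (simp add: w_poly_def dual_norm_power_orthogonal[OF ann])
        qed (simp add: above)
      qed
    qed auto
    \<comment> \<open>On \<open>J\<close> every \<open>w_poly lam j\<close> has the same exponent
      \<open>k\<close>, so linearity of \<open>dual_norm_power k\<close> gathers the columns into
      \<open>l\<close>.\<close>
    also have "\<dots> = dual_app (lam i) (dual_norm_power k l)"
      by (simp add: l_def w_poly_def J_def linear_sum[OF linear_dual_norm_power]
          linear_scale[OF linear_dual_norm_power] linear_sum[OF linear_dual_app]
          linear_scale[OF linear_dual_app] mult.commute)
    finally show ?thesis by simp
  qed
  then have "dual_app l (dual_norm_power k l) = 0"
    by (subst l_def) (simp add: dual_app_sum scaleR_alg_dual.rep_eq)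
  with l_ann have "annihilates l (poly_lt (Suc k))" by (rule dual_norm_power_definite)
  moreover have "l \<in> M"
  proof -
    have "M = span (range lam)" using basis by (simp add: family_basis_def)
    then show ?thesis
      unfolding l_def by (simp only:) (intro span_sum span_scale span_base rangeI)
  qed
  ultimately have "l \<in> span (lam ` {i. Suc k \<le> ?\<kappa> i})"
    using basis_ge[of "Suc k"] by (simp add: family_basis_def annihilator_def)
  then obtain d where d: "l = (\<Sum>i | Suc k \<le> ?\<kappa> i. d i *\<^sub>R lam i)"
    by (rule span_image_finite_obtain[OF finite])
  \<comment> \<open>The coefficients of \<open>l - l\<close> from the two expressions for
    \<open>l\<close>. At \<open>j0\<close>, of order exactly \<open>k\<close>, the second part is 0,
    which leaves \<open>c $ j0\<close>.\<close>
  let ?e = "\<lambda>i. (if i \<in> J then c $ i else 0) - (if Suc k \<le> ?\<kappa> i then d i else 0)"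
  have restrict: "(\<Sum>i\<in>UNIV. (if i \<in> A then u i else 0) *\<^sub>R lam i) = (\<Sum>i\<in>A. u i *\<^sub>R lam i)"
    for A u
    by (rule sum.mono_neutral_cong_right) auto
  have "(\<Sum>i\<in>UNIV. ?e i *\<^sub>R lam i) = l - l"
    using restrict[of J "($) c"] restrict[of "{i. Suc k \<le> ?\<kappa> i}" d]
    unfolding scaleR_diff_left sum_subtractf
    by (simp only: l_def[symmetric] d[symmetric] mem_Collect_eq)
  then have "?e j0 = 0"
    using family_basis_coeffs_zero[OF basis, of ?e] by simp
  with j0(2) show False by (simp add: J_def k_def)
qed

section \<open>The projector\<close>

lemma linear_W_map: "linear (W_map lam)"
  unfolding W_map_def
  by (rule linearI) (simp_all add: scaleR_add_left sum.distrib scaleR_sum_right)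

lemma linear_Lambda_t: "linear (Lambda_t lam)"
  unfolding Lambda_t_def
  by (rule linearI) (simp_all add: vec_eq_iff linear_add[OF linear_dual_app]
      linear_scale[OF linear_dual_app])

text \<open>Thus the \<open>inv\<close> in \<open>P_S\<close> is a genuine inverse once the Gram
  matrix is known to be invertible.\<close>

lemma Lambda_t_W_map: "Lambda_t lam \<circ> W_map lam = (*v) (gram lam)"
  by (simp add: fun_eq_iff vec_eq_iff Lambda_t_def W_map_def gram_def matrix_vector_mult_def
      linear_sum[OF linear_dual_app] linear_scale[OF linear_dual_app] mult.commute)

lemma range_W_map: "range (W_map lam) = span (range (w_poly lam))"
proof
  show "range (W_map lam) \<subseteq> span (range (w_poly lam))"
    unfolding W_map_def
    by (rule image_subsetI, rule span_sum, rule span_scale, rule span_base, rule rangeI)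
  show "span (range (w_poly lam)) \<subseteq> range (W_map lam)"
  proof
    fix f assume "f \<in> span (range (w_poly lam))"
    then obtain d where "f = (\<Sum>i\<in>UNIV. d i *\<^sub>R w_poly lam i)"
      by (rule span_image_finite_obtain[OF finite])
    then have "f = W_map lam (\<chi> i. d i)" by (simp add: W_map_def)
    then show "f \<in> range (W_map lam)" by blast
  qed
qed

text \<open>Evaluation at a fixed polynomial is linear in the functional, so agreement on generators
  suffices.\<close>

lemma match_on_span_iff:
  "(\<forall>\<mu>\<in>span (range lam). dual_app \<mu> f = dual_app \<mu> p) \<longleftrightarrow> Lambda_t lam f = Lambda_t lam p"
proof
  assume "\<forall>\<mu>\<in>span (range lam). dual_app \<mu> f = dual_app \<mu> p"
  then show "Lambda_t lam f = Lambda_t lam p"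
    by (simp add: Lambda_t_def vec_eq_iff span_base)
next
  assume eq: "Lambda_t lam f = Lambda_t lam p"
  show "\<forall>\<mu>\<in>span (range lam). dual_app \<mu> f = dual_app \<mu> p"
  proof
    fix \<mu> assume "\<mu> \<in> span (range lam)"
    then show "dual_app \<mu> f = dual_app \<mu> p"
      by (rule linear_eq_on[OF linear_dual_app_left linear_dual_app_left])
        (use eq in \<open>auto simp: Lambda_t_def vec_eq_iff\<close>)
  qed
qed

theorem mainTheorem4:
  fixes M :: "('d::finite) poly_space alg_dual set"
    and lam :: "'n::{finite,linorder} \<Rightarrow> 'd poly_space alg_dual"
    and F :: "'d poly_space set"
  assumes "subspace M"
    and "dim M = CARD('n)"
    and "graded_basis lam M"
    and "F = span (range (w_poly lam))"
  shows "invertible (gram lam) \<and>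
    bij (Lambda_t lam \<circ> W_map lam) \<and>
    linear (P_S lam) \<and>
    P_S lam \<circ> P_S lam = P_S lam \<and>
    (\<forall>p. P_S lam p \<in> F \<and> (\<forall>\<mu>\<in>M. dual_app \<mu> (P_S lam p) = dual_app \<mu> p)) \<and>
    (\<forall>p. \<exists>!f. f \<in> F \<and> (\<forall>\<mu>\<in>M. dual_app \<mu> f = dual_app \<mu> p))"
proof -
  let ?G = "Lambda_t lam \<circ> W_map lam"
  have M: "M = span (range lam)"
    using assms(3) by (simp add: graded_basis_def family_basis_def)
  have F: "F = range (W_map lam)" by (simp add: assms(4) range_W_map)
  have inv: "invertible (gram lam)"
    unfolding invertible_left_inverse matrix_left_invertible_ker
    using graded_basis_gram_kernel[OF assms(3)] by blast
  then have bij: "bij ?G"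
    unfolding Lambda_t_W_map by (simp add: invertible_eq_bij)
  then have GG: "?G (inv_into UNIV ?G v) = v" and GG': "inv_into UNIV ?G (?G v) = v" for v
    by (simp_all only: surj_f_inv_f bij_is_surj inv_f_f bij_is_inj)
  have "linear ?G" by (rule linear_compose[OF linear_W_map linear_Lambda_t])
  then have "linear (inv_into UNIV ?G)"
    by (rule inj_linear_imp_inv_linear[OF _ bij_is_inj[OF bij]])
  then have lin: "linear (P_S lam)"
    unfolding P_S_def by (intro linear_compose linear_W_map linear_Lambda_t)
  have match: "Lambda_t lam (P_S lam p) = Lambda_t lam p" for p
    using GG[of "Lambda_t lam p"] by (simp add: P_S_def)
  have in_F: "P_S lam p \<in> F" for p by (simp add: P_S_def F)
  have fixed: "P_S lam f = P_S lam p" if "Lambda_t lam f = Lambda_t lam p" for f p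
    using that by (simp add: P_S_def)
  have on_F: "P_S lam f = f" if "f \<in> F" for f
  proof -
    from that obtain a where "f = W_map lam a" by (auto simp: F)
    then show ?thesis using GG'[of a] by (simp add: P_S_def)
  qed
  have "P_S lam \<circ> P_S lam = P_S lam" by (simp add: fun_eq_iff on_F in_F)
  \<comment> \<open>Uniqueness: an \<open>f\<close> in \<open>F\<close> with the data of
    \<open>p\<close> satisfies \<open>f = P_S lam f = P_S lam p\<close>.\<close>
  moreover have "\<exists>!f. f \<in> F \<and> Lambda_t lam f = Lambda_t lam p" for p
    using in_F match fixed on_F by (metis (no_types))
  ultimately show ?thesis
    using inv bij lin in_F match unfolding M match_on_span_iff by blast
qed

end
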